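(* Assume that the unperturbed system $\dot x=X^0(x)$ on $\mathscr{M}$ has a $T$-periodic orbit $\gamma(t)$ for some constant $T>0$, and that it has a $C^3$ commutative vector field $Z$ (i.e. $[X^0,Z]=0$) near $\Gamma=\{\gamma(t)\mid t\in[0,T)\}$ which is linearly independent of $X^0$. Let $\omega:\Gamma\to T^*_\Gamma$ be a nontrivial section satisfying the adjoint variational equation of $X^0$ along $\Gamma$. If the perturbed system $\dot x=X_\varepsilon(x)$ has a $C^3$ commutative vector field $Z_\varepsilon$ (i.e. $[X_\varepsilon,Z_\varepsilon]=0$) depending $C^2$-smoothly on $\varepsilon$ near $\Gamma$ such that $Z_0=Z$, then $$\mathscr{J}_{\omega,Z,\gamma}:=\int_0^T\omega([X^1,Z])(\gamma(t))\,dt=0 .$$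
   Context: $\mathscr{M}$ is an $n$-dimensional ($n\ge2$) paracompact oriented $C^4$ real manifold. $\varepsilon$ is a small parameter, $0\le\varepsilon\ll1$, and $X_\varepsilon$ is a family of vector fields on $\mathscr{M}$ that is $C^3$ with respect to $x$ and $\varepsilon$, with $X_\varepsilon(x)=X^0(x)+\varepsilon X^1(x)+O(\varepsilon^2)$. $[\cdot,\cdot]$ is the Lie bracket of vector fields. The periodic orbit $\gamma$ is a non-stationary solution. Adjoint variational equation (AVE): let $X$ be a vector field on $\mathscr{M}$ and $\Gamma_\phi$ an integral curve given by a non-stationary solution $x=\phi(t)$ of $\dot x=X(x)$, with immersion $i:\Gamma_\phi\to\mathscr{M}$. Put $T_{\Gamma_\phi}=i^*T\mathscr{M}$ and let $T^*_{\Gamma_\phi}$ be its dual bundle. A $C^1$ section $\alpha$ of $T^*_{\Gamma_\phi}$ satisfies the AVE of $X$ along $\Gamma_\phi$ if $\nabla^*\alpha:=dt\otimes\mathcal{L}_X\tilde\alpha|_{\Gamma_\phi}=0$, where $\tilde\alpha$ is any $C^1$ differential 1-form extending $\alpha$ and $\mathcal{L}_X$ is the Lie derivative. In local coordinates, with $\alpha=\sum_j\eta_j\,dx_j$, this reads $\dot\eta=-\left(\frac{\partial X}{\partial x}(\phi(t))\right)^{\mathrm T}\eta$. A section satisfying the AVE is called a horizontal section of $\nabla^*$; a section over the closed curve $\Gamma$ corresponds to a periodic solution. Such nontrivial $\omega$ always exists along a periodic orbit. *)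

theory Defs
  imports "HOL-Analysis.Analysis" "HOL-Library.Landau_Symbols"
begin

section \<open>Functions of class C^k\<close>

text \<open>
  Derivatives are taken within \<open>S\<close>, so that \<open>S\<close> may be an open set or a product of an open set
  with a half-open parameter interval \<open>{0..<e}\<close> (one-sided derivative in the parameter at 0).
  On such sets the derivative within \<open>S\<close> is unique.
\<close>

fun Ck_on :: "nat \<Rightarrow> ('v::real_normed_vector \<Rightarrow> 'w::real_normed_vector) \<Rightarrow> 'v set \<Rightarrow> bool" where
  "Ck_on 0 f S \<longleftrightarrow> continuous_on S f"
| "Ck_on (Suc k) f S \<longleftrightarrow> f differentiable_on S \<and>
     (\<forall>v. Ck_on k (\<lambda>x. frechet_derivative f (at x within S) v) S)"


section \<open>Oriented manifolds of class C^k\<close>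

type_synonym ('a, 'n) chart = "'a set \<times> ('a \<Rightarrow> real ^ 'n)"

definition is_chart :: "'a topology \<Rightarrow> ('a, 'n::finite) chart \<Rightarrow> bool" where
  "is_chart M c \<longleftrightarrow> openin M (fst c) \<and> open (snd c ` fst c) \<and>
     homeomorphic_map (subtopology M (fst c)) (top_of_set (snd c ` fst c)) (snd c)"

definition chart_inv :: "('a, 'n::finite) chart \<Rightarrow> real ^ 'n \<Rightarrow> 'a" where
  "chart_inv c = inv_into (fst c) (snd c)"

definition transition ::
    "('a, 'n::finite) chart \<Rightarrow> ('a, 'n) chart \<Rightarrow> real ^ 'n \<Rightarrow> real ^ 'n" where
  "transition c d = snd d \<circ> chart_inv c"

definition paracompact :: "'a topology \<Rightarrow> bool" where
  "paracompact M \<longleftrightarrow> (\<forall>\<U>. (\<forall>U\<in>\<U>. openin M U) \<and> \<Union>\<U> = topspace M \<longrightarrow>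
     (\<exists>\<V>. (\<forall>V\<in>\<V>. openin M V \<and> (\<exists>U\<in>\<U>. V \<subseteq> U)) \<and> \<Union>\<V> = topspace M \<and> locally_finite_in M \<V>))"

text \<open>The orientation is given by the atlas: all its transition maps preserve orientation.\<close>

definition oriented_Ck_manifold ::
    "nat \<Rightarrow> 'a topology \<Rightarrow> ('a, 'n::finite) chart set \<Rightarrow> bool" where
  "oriented_Ck_manifold k M A \<longleftrightarrow>
     Hausdorff_space M \<and> paracompact M \<and>
     (\<forall>c\<in>A. is_chart M c) \<and> (\<Union>c\<in>A. fst c) = topspace M \<and>
     (\<forall>c\<in>A. \<forall>d\<in>A. Ck_on k (transition c d) (snd c ` (fst c \<inter> fst d)) \<and>
        (\<forall>p\<in>fst c \<inter> fst d.
           det (matrix (frechet_derivative (transition c d) (at (snd c p)))) > 0))"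


section \<open>Tangent and cotangent vectors, vector fields, 1-forms\<close>

text \<open>
  A tangent (cotangent) vector at \<open>p\<close> is the family of its coordinate vectors in all charts around
  \<open>p\<close>, subject to the transformation law; the components for charts not around \<open>p\<close> are
  normalised to 0, so that equality of (co)tangent vectors is equality of functions.
\<close>

type_synonym ('a, 'n) tvec = "('a, 'n) chart \<Rightarrow> real ^ 'n"

definition tangent_space :: "('a, 'n::finite) chart set \<Rightarrow> 'a \<Rightarrow> ('a, 'n) tvec set" where
  "tangent_space A p = {v. (\<forall>c. \<not> (c \<in> A \<and> p \<in> fst c) \<longrightarrow> v c = 0) \<and>
     (\<forall>c\<in>A. \<forall>d\<in>A. p \<in> fst c \<inter> fst d \<longrightarrow>
        v d = frechet_derivative (transition c d) (at (snd c p)) (v c))}"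

definition cotangent_space :: "('a, 'n::finite) chart set \<Rightarrow> 'a \<Rightarrow> ('a, 'n) tvec set" where
  "cotangent_space A p = {w. (\<forall>c. \<not> (c \<in> A \<and> p \<in> fst c) \<longrightarrow> w c = 0) \<and>
     (\<forall>c\<in>A. \<forall>d\<in>A. p \<in> fst c \<inter> fst d \<longrightarrow>
        (\<forall>u. w c \<bullet> u = w d \<bullet> frechet_derivative (transition c d) (at (snd c p)) u))}"

definition pairing ::
    "('a, 'n::finite) chart set \<Rightarrow> 'a \<Rightarrow> ('a, 'n) tvec \<Rightarrow> ('a, 'n) tvec \<Rightarrow> real" where
  "pairing A p w v = (let c = (SOME c. c \<in> A \<and> p \<in> fst c) in w c \<bullet> v c)"

lemma pairing_chart_independent:
  assumes "w \<in> cotangent_space A p" "v \<in> tangent_space A p" "c \<in> A" "p \<in> fst c"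
  shows "pairing A p w v = w c \<bullet> v c"
proof -
  define d where "d = (SOME d. d \<in> A \<and> p \<in> fst d)"
  have d: "d \<in> A" "p \<in> fst d"
    using someI[of "\<lambda>d. d \<in> A \<and> p \<in> fst d" c] assms(3,4) unfolding d_def by auto
  have "w d \<bullet> v d = w c \<bullet> frechet_derivative (transition d c) (at (snd d p)) (v d)"
    using assms(1,3,4) d unfolding cotangent_space_def by blast
  also have "frechet_derivative (transition d c) (at (snd d p)) (v d) = v c"
    using assms(2,3,4) d unfolding tangent_space_def mem_Collect_eq by (metis IntI)
  finally show ?thesis
    unfolding pairing_def Let_def d_def .
qed

text \<open>Coordinate representation of a vector field or 1-form in the chart \<open>c\<close>.\<close>

definition coord :: "('a, 'n::finite) chart \<Rightarrow> ('a \<Rightarrow> ('a, 'n) tvec) \<Rightarrow> real ^ 'n \<Rightarrow> real ^ 'n" where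
  "coord c X = (\<lambda>x. X (chart_inv c x) c)"

definition vector_field ::
    "('a, 'n::finite) chart set \<Rightarrow> 'a set \<Rightarrow> ('a \<Rightarrow> ('a, 'n) tvec) \<Rightarrow> bool" where
  "vector_field A U X \<longleftrightarrow> (\<forall>p\<in>U. X p \<in> tangent_space A p)"

definition Ck_vector_field ::
    "nat \<Rightarrow> ('a, 'n::finite) chart set \<Rightarrow> 'a set \<Rightarrow> ('a \<Rightarrow> ('a, 'n) tvec) \<Rightarrow> bool" where
  "Ck_vector_field k A U X \<longleftrightarrow> vector_field A U X \<and>
     (\<forall>c\<in>A. Ck_on k (coord c X) (snd c ` (fst c \<inter> U)))"

text \<open>Families of vector fields that are C^k jointly in the point and the parameter.\<close>

definition Ck_vector_field_family :: "nat \<Rightarrow> ('a, 'n::finite) chart set \<Rightarrow> 'a set \<Rightarrow> real set \<Rightarrow>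
    (real \<Rightarrow> 'a \<Rightarrow> ('a, 'n) tvec) \<Rightarrow> bool" where
  "Ck_vector_field_family k A U I X \<longleftrightarrow> (\<forall>e\<in>I. vector_field A U (X e)) \<and>
     (\<forall>c\<in>A. Ck_on k (\<lambda>(x, e). coord c (X e) x) ((snd c ` (fst c \<inter> U)) \<times> I))"

definition Ck_one_form ::
    "nat \<Rightarrow> ('a, 'n::finite) chart set \<Rightarrow> 'a set \<Rightarrow> ('a \<Rightarrow> ('a, 'n) tvec) \<Rightarrow> bool" where
  "Ck_one_form k A U \<alpha> \<longleftrightarrow> (\<forall>p\<in>U. \<alpha> p \<in> cotangent_space A p) \<and>
     (\<forall>c\<in>A. Ck_on k (coord c \<alpha>) (snd c ` (fst c \<inter> U)))"

definition pointwise_lin_indep :: "('a, 'n::finite) chart set \<Rightarrow> 'a set \<Rightarrow>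
    ('a \<Rightarrow> ('a, 'n) tvec) \<Rightarrow> ('a \<Rightarrow> ('a, 'n) tvec) \<Rightarrow> bool" where
  "pointwise_lin_indep A U X Y \<longleftrightarrow> (\<forall>p\<in>U. \<forall>a b::real.
     (\<forall>c\<in>A. p \<in> fst c \<longrightarrow> a *\<^sub>R X p c + b *\<^sub>R Y p c = 0) \<longrightarrow> a = 0 \<and> b = 0)"


section \<open>Lie bracket and Lie derivative\<close>

text \<open>\<open>[X, Y] = DY X - DX Y\<close> in every chart.\<close>

definition lie_bracket :: "('a, 'n::finite) chart set \<Rightarrow>
    ('a \<Rightarrow> ('a, 'n) tvec) \<Rightarrow> ('a \<Rightarrow> ('a, 'n) tvec) \<Rightarrow> 'a \<Rightarrow> ('a, 'n) tvec" where
  "lie_bracket A X Y p = (\<lambda>c. if c \<in> A \<and> p \<in> fst c then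
       frechet_derivative (coord c Y) (at (snd c p)) (X p c)
     - frechet_derivative (coord c X) (at (snd c p)) (Y p c) else 0)"

definition commute_on :: "('a, 'n::finite) chart set \<Rightarrow> 'a set \<Rightarrow>
    ('a \<Rightarrow> ('a, 'n) tvec) \<Rightarrow> ('a \<Rightarrow> ('a, 'n) tvec) \<Rightarrow> bool" where
  "commute_on A U X Y \<longleftrightarrow> (\<forall>p\<in>U. lie_bracket A X Y p = (\<lambda>_. 0))"

text \<open>
  The Lie derivative of the 1-form \<open>\<Sum>\<^sub>j \<eta>\<^sub>j dx\<^sub>j\<close> along \<open>X\<close> has the coordinates
  \<open>\<Sum>\<^sub>k X\<^sub>k \<partial>\<^sub>k \<eta>\<^sub>j + \<Sum>\<^sub>k \<eta>\<^sub>k \<partial>\<^sub>j X\<^sub>k\<close>.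
\<close>

definition lie_derivative_form :: "('a, 'n::finite) chart set \<Rightarrow>
    ('a \<Rightarrow> ('a, 'n) tvec) \<Rightarrow> ('a \<Rightarrow> ('a, 'n) tvec) \<Rightarrow> 'a \<Rightarrow> ('a, 'n) tvec" where
  "lie_derivative_form A X \<alpha> p = (\<lambda>c. if c \<in> A \<and> p \<in> fst c then
       frechet_derivative (coord c \<alpha>) (at (snd c p)) (X p c)
     + adjoint (frechet_derivative (coord c X) (at (snd c p))) (\<alpha> p c) else 0)"


section \<open>Periodic orbits and the adjoint variational equation\<close>

definition integral_curve :: "'a topology \<Rightarrow> ('a, 'n::finite) chart set \<Rightarrow>
    ('a \<Rightarrow> ('a, 'n) tvec) \<Rightarrow> (real \<Rightarrow> 'a) \<Rightarrow> bool" where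
  "integral_curve M A X \<gamma> \<longleftrightarrow> continuous_map euclideanreal M \<gamma> \<and>
     (\<forall>t. \<forall>c\<in>A. \<gamma> t \<in> fst c \<longrightarrow>
        ((\<lambda>s. snd c (\<gamma> s)) has_vector_derivative X (\<gamma> t) c) (at t))"

text \<open>\<open>T\<close> need not be the minimal period; stationary solutions are excluded.\<close>

definition periodic_orbit :: "'a topology \<Rightarrow> ('a, 'n::finite) chart set \<Rightarrow>
    ('a \<Rightarrow> ('a, 'n) tvec) \<Rightarrow> real \<Rightarrow> (real \<Rightarrow> 'a) \<Rightarrow> bool" where
  "periodic_orbit M A X T \<gamma> \<longleftrightarrow> integral_curve M A X \<gamma> \<and>
     (\<forall>t. \<gamma> (t + T) = \<gamma> t) \<and> (\<exists>s t. \<gamma> s \<noteq> \<gamma> t)"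

definition C1_covector_section :: "('a, 'n::finite) chart set \<Rightarrow> (real \<Rightarrow> 'a) \<Rightarrow>
    ('a \<Rightarrow> ('a, 'n) tvec) \<Rightarrow> bool" where
  "C1_covector_section A \<gamma> \<omega> \<longleftrightarrow> (\<forall>t. \<omega> (\<gamma> t) \<in> cotangent_space A (\<gamma> t)) \<and>
     (\<forall>c\<in>A. Ck_on 1 (\<lambda>t. \<omega> (\<gamma> t) c) {t. \<gamma> t \<in> fst c})"

text \<open>
  The Lie derivative on the curve does not depend on the extension \<open>\<alpha>\<close> of the section \<open>\<omega>\<close> (cf.
  \<open>satisfies_AVE_coord\<close> below), and along a periodic orbit, an embedded circle, every C^1
  section has an extension; so the condition may be stated with some extension.
\<close>

definition satisfies_AVE :: "'a topology \<Rightarrow> ('a, 'n::finite) chart set \<Rightarrow>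
    ('a \<Rightarrow> ('a, 'n) tvec) \<Rightarrow> (real \<Rightarrow> 'a) \<Rightarrow> ('a \<Rightarrow> ('a, 'n) tvec) \<Rightarrow> bool" where
  "satisfies_AVE M A X \<gamma> \<omega> \<longleftrightarrow> C1_covector_section A \<gamma> \<omega> \<and>
     (\<exists>W \<alpha>. openin M W \<and> range \<gamma> \<subseteq> W \<and> Ck_one_form 1 A W \<alpha> \<and>
        (\<forall>p\<in>range \<gamma>. \<alpha> p = \<omega> p \<and> lie_derivative_form A X \<alpha> p = (\<lambda>_. 0)))"

lemma lie_derivative_form_along_curve:
  assumes M: "oriented_Ck_manifold k M A" and X: "integral_curve M A X \<gamma>"
    and W: "openin M W" "range \<gamma> \<subseteq> W" and \<alpha>: "Ck_one_form 1 A W \<alpha>"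
    and ext: "\<forall>p\<in>range \<gamma>. \<alpha> p = \<omega> p" and c: "c \<in> A" "\<gamma> t \<in> fst c"
  shows "((\<lambda>s. \<omega> (\<gamma> s) c) has_vector_derivative
           lie_derivative_form A X \<alpha> (\<gamma> t) c
           - adjoint (frechet_derivative (coord c X) (at (snd c (\<gamma> t)))) (\<omega> (\<gamma> t) c)) (at t)"
proof -
  let ?S = "snd c ` (fst c \<inter> W)" and ?x = "snd c (\<gamma> t)"
  have ch: "is_chart M c"
    using M c unfolding oriented_Ck_manifold_def by blast
  have hom: "homeomorphic_map (subtopology M (fst c)) (top_of_set (snd c ` fst c)) (snd c)"
    and op: "open (snd c ` fst c)" and oc: "openin M (fst c)"
    using ch unfolding is_chart_def by auto
  have sub: "fst c \<subseteq> topspace M"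
    using oc by (rule openin_subset)
  then have inj: "inj_on (snd c) (fst c)"
    using homeomorphic_imp_injective_map[OF hom] by (simp add: Int_absorb1)
  have "openin (subtopology M (fst c)) (fst c \<inter> W)"
    using W(1) by (simp add: openin_subtopology_Int2)
  then have "openin (top_of_set (snd c ` fst c)) ?S"
    using homeomorphic_imp_open_map[OF hom] unfolding open_map_def by blast
  then have S: "open ?S"
    using op openin_open_trans by blast
  have x: "?x \<in> ?S"
    using c W(2) by auto
  have "coord c \<alpha> differentiable_on ?S"
    using \<alpha> c unfolding Ck_one_form_def by auto
  then have "coord c \<alpha> differentiable (at ?x)"
    using x differentiable_on_eq_differentiable_at[OF S] by blast
  then have 1: "(coord c \<alpha> has_derivative frechet_derivative (coord c \<alpha>) (at ?x)) (at ?x)"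
    by (simp add: frechet_derivative_works)
  have 2: "((\<lambda>s. snd c (\<gamma> s)) has_vector_derivative X (\<gamma> t) c) (at t)"
    using X c unfolding integral_curve_def by blast
  have 3: "((\<lambda>s. coord c \<alpha> (snd c (\<gamma> s))) has_vector_derivative
              frechet_derivative (coord c \<alpha>) (at ?x) (X (\<gamma> t) c)) (at t)"
    using vector_derivative_diff_chain_within[OF 2 has_derivative_at_withinI[OF 1]]
    by (simp add: o_def)
  have "openin euclideanreal {s \<in> topspace euclideanreal. \<gamma> s \<in> fst c}"
    using X oc unfolding integral_curve_def by (blast intro: openin_continuous_map_preimage)
  then have opt: "open {s. \<gamma> s \<in> fst c}"
    by simp
  have eq: "coord c \<alpha> (snd c (\<gamma> s)) = \<omega> (\<gamma> s) c" if "s \<in> {s. \<gamma> s \<in> fst c}" for s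
    using that inj ext by (simp add: coord_def chart_inv_def)
  have "((\<lambda>s. \<omega> (\<gamma> s) c) has_vector_derivative
           frechet_derivative (coord c \<alpha>) (at ?x) (X (\<gamma> t) c)) (at t)"
    using has_vector_derivative_transform_within_open[OF 3 opt _ eq] c by simp
  then show ?thesis
    using c ext by (simp add: lie_derivative_form_def)
qed

lemma satisfies_AVE_coord:
  assumes "oriented_Ck_manifold k M A" "integral_curve M A X \<gamma>" "satisfies_AVE M A X \<gamma> \<omega>"
    and "c \<in> A" "\<gamma> t \<in> fst c"
  shows "((\<lambda>s. \<omega> (\<gamma> s) c) has_vector_derivative
           - adjoint (frechet_derivative (coord c X) (at (snd c (\<gamma> t)))) (\<omega> (\<gamma> t) c)) (at t)"
proof -
  obtain W \<alpha> where W: "openin M W" "range \<gamma> \<subseteq> W" "Ck_one_form 1 A W \<alpha>"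
    and e: "\<forall>p\<in>range \<gamma>. \<alpha> p = \<omega> p \<and> lie_derivative_form A X \<alpha> p = (\<lambda>_. 0)"
    using assms(3) unfolding satisfies_AVE_def by blast
  have ext: "\<forall>p\<in>range \<gamma>. \<alpha> p = \<omega> p" and 0: "lie_derivative_form A X \<alpha> (\<gamma> t) c = 0"
    using e by auto
  show ?thesis
    using lie_derivative_form_along_curve[OF assms(1,2) W ext assms(4,5)]
    by (simp only: 0 diff_0)
qed

end

theory Submission
  imports Defs
begin

text \<open>
  The integrand is minus the derivative of a \<open>T\<close>-periodic function. Let \<open>Z1\<close> be the derivative of the
  commuting fields \<open>Z\<^sub>\<epsilon>\<close> with respect to \<open>\<epsilon>\<close> at \<open>0\<close>. Differentiating \<open>[X\<^sub>\<epsilon>, Z\<^sub>\<epsilon>] = 0\<close> at \<open>\<epsilon> = 0\<close> gives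
  \<open>[X0, Z1] = - [X1, Z]\<close> near the orbit. On the other hand, since \<open>\<omega>\<close> solves the adjoint variational
  equation, \<open>d/dt \<omega>(Z1)(\<gamma> t) = \<omega>([X0, Z1])(\<gamma> t)\<close>. So the integral of \<open>\<omega>([X1, Z])\<close> over a period is
  \<open>\<omega>(Z1)(\<gamma> 0) - \<omega>(Z1)(\<gamma> T)\<close>, which vanishes because \<open>\<gamma> T = \<gamma> 0\<close>.

  The two halves are \<open>commuting_families_first_variation\<close> and
  \<open>adjoint_variational_pairing_derivative\<close>. The analytic difficulty is in the first: a bracket contains
  space derivatives, so differentiating it in \<open>\<epsilon>\<close> interchanges derivatives in space and in the
  parameter, at a boundary point of the parameter interval. This is
  \<open>mixed_derivatives_at_boundary\<close>, which rests on the mean value theorem for second differences.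
  The parameter derivative of \<open>X\<^sub>\<epsilon>\<close> at \<open>0\<close> is \<open>X1\<close> by \<open>first_order_expansion_at_right\<close>, and \<open>Z1\<close> is
  a vector field, so that its pairing with \<open>\<omega>\<close> is independent of charts, by
  \<open>tangent_space_parameter_derivative\<close>.
\<close>

section \<open>Mixed second derivatives at the boundary of the parameter interval\<close>

lemma Ck_on_Suc_imp: "Ck_on (Suc k) f S \<Longrightarrow> Ck_on k f S"
proof (induction k arbitrary: f)
  case 0
  then show ?case by (simp add: differentiable_imp_continuous_on)
next
  case (Suc k)
  show ?case
    using Suc.prems Suc.IH unfolding Ck_on.simps(2)[of "Suc k"] Ck_on.simps(2)[of k] by blast
qed

lemma Ck_on_2_has_derivatives:
  assumes "Ck_on 2 f D"
  defines "f1 \<equiv> \<lambda>v p. frechet_derivative f (at p within D) v"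
  shows "\<And>p. p \<in> D \<Longrightarrow> (f has_derivative (\<lambda>v. f1 v p)) (at p within D)"
    and "\<And>p v. p \<in> D \<Longrightarrow>
      (f1 v has_derivative frechet_derivative (f1 v) (at p within D)) (at p within D)"
    and "\<And>v w. continuous_on D (\<lambda>p. frechet_derivative (f1 v) (at p within D) w)"
proof -
  have f: "f differentiable_on D" "\<And>v. f1 v differentiable_on D"
    "\<And>v w. continuous_on D (\<lambda>p. frechet_derivative (f1 v) (at p within D) w)"
    using assms(1) unfolding f1_def numeral_2_eq_2 Ck_on.simps by blast+
  show "(f has_derivative (\<lambda>v. f1 v p)) (at p within D)" if "p \<in> D" for p
    using f(1) that frechet_derivative_works[of f "at p within D"]
    unfolding f1_def differentiable_on_def by blast
  show "(f1 v has_derivative frechet_derivative (f1 v) (at p within D)) (at p within D)"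
    if "p \<in> D" for p v
    using f(2)[of v] that frechet_derivative_works[of "f1 v" "at p within D"]
    unfolding differentiable_on_def by blast
  show "continuous_on D (\<lambda>p. frechet_derivative (f1 v) (at p within D) w)" for v w
    by (rule f(3))
qed

text \<open>
  The second difference of \<open>h\<close> over a square is a value of its mixed derivative, by the mean value
  theorem applied in one variable after the other. The expression on the left is symmetric in the two
  variables, so the same statement with the variables exchanged compares the two mixed derivatives.
\<close>

lemma second_difference_mean_value:
  fixes h hs hse :: "real \<Rightarrow> real \<Rightarrow> real"
  assumes d: "0 < d" "d < r"
    and ds: "\<And>s e. s \<in> {0..<r} \<Longrightarrow> e \<in> {0..<r} \<Longrightarrow>
      ((\<lambda>s. h s e) has_real_derivative hs s e) (at s within {0..<r})"
    and dse: "\<And>s e. s \<in> {0..<r} \<Longrightarrow> e \<in> {0..<r} \<Longrightarrow>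
      ((\<lambda>e. hs s e) has_real_derivative hse s e) (at e within {0..<r})"
  obtains s e where "s \<in> {0<..<d}" "e \<in> {0<..<d}"
    "h d d - h 0 d - h d 0 + h 0 0 = d * d * hse s e"
proof -
  have sub: "{0..d} \<subseteq> {0..<r}" using d by auto
  have "\<exists>s\<in>{0<..<d}. (h d d - h d 0) - (h 0 d - h 0 0) = (hs s d - hs s 0) * (d - 0)"
  proof (rule mvt_simple)
    fix s assume "0 \<le> s" "s \<le> d"
    then have "((\<lambda>s. h s d - h s 0) has_real_derivative hs s d - hs s 0) (at s within {0..d})"
      using d by (intro DERIV_subset[OF DERIV_diff[OF ds ds] sub]) auto
    then show "((\<lambda>s. h s d - h s 0) has_derivative (\<lambda>y. (hs s d - hs s 0) * y)) (at s within {0..d})"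
      by (simp add: has_field_derivative_def)
  qed (use d in auto)
  then obtain s where s: "s \<in> {0<..<d}"
    and 1: "(h d d - h d 0) - (h 0 d - h 0 0) = (hs s d - hs s 0) * d" by auto
  have "\<exists>e\<in>{0<..<d}. hs s d - hs s 0 = hse s e * (d - 0)"
  proof (rule mvt_simple)
    fix e assume "0 \<le> e" "e \<le> d"
    then have "((\<lambda>e. hs s e) has_real_derivative hse s e) (at e within {0..d})"
      using d s by (intro DERIV_subset[OF dse sub]) auto
    then show "((\<lambda>e. hs s e) has_derivative (\<lambda>y. hse s e * y)) (at e within {0..d})"
      by (simp add: has_field_derivative_def)
  qed (use d in auto)
  then obtain e where e: "e \<in> {0<..<d}" and 2: "hs s d - hs s 0 = hse s e * d" by auto
  show thesis
    by (rule that[OF s e]) (use 1 2 in \<open>simp add: algebra_simps\<close>)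
qed

text \<open>
  Both mixed derivatives are limits, over shrinking squares at the corner, of the same normalised
  second difference; continuity on the quadrant, up to the corner, identifies the limits.
\<close>

lemma mixed_partials_at_corner:
  fixes h hs he hse hes :: "real \<Rightarrow> real \<Rightarrow> real"
  assumes r: "0 < r"
    and ds: "\<And>s e. s \<in> {0..<r} \<Longrightarrow> e \<in> {0..<r} \<Longrightarrow>
      ((\<lambda>s. h s e) has_real_derivative hs s e) (at s within {0..<r})"
    and de: "\<And>s e. s \<in> {0..<r} \<Longrightarrow> e \<in> {0..<r} \<Longrightarrow>
      ((\<lambda>e. h s e) has_real_derivative he s e) (at e within {0..<r})"
    and dse: "\<And>s e. s \<in> {0..<r} \<Longrightarrow> e \<in> {0..<r} \<Longrightarrow>
      ((\<lambda>e. hs s e) has_real_derivative hse s e) (at e within {0..<r})"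
    and des: "\<And>s e. s \<in> {0..<r} \<Longrightarrow> e \<in> {0..<r} \<Longrightarrow>
      ((\<lambda>s. he s e) has_real_derivative hes s e) (at s within {0..<r})"
    and cse: "continuous_on ({0..<r} \<times> {0..<r}) (\<lambda>(s, e). hse s e)"
    and ces: "continuous_on ({0..<r} \<times> {0..<r}) (\<lambda>(s, e). hes s e)"
  shows "hse 0 0 = hes 0 0"
proof -
  \<comment> \<open>the shift by 2 keeps the side lengths strictly below \<open>r\<close>\<close>
  define d where "d n = r / real (n + 2)" for n
  have d: "0 < d n" "d n < r" for n
    using r by (auto simp: d_def field_simps add_pos_nonneg)
  have dlim: "d \<longlonglongrightarrow> 0"
    unfolding d_def by (intro tendsto_divide_0[OF tendsto_const] filterlim_at_top_imp_at_infinity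
        filterlim_compose[OF filterlim_real_sequentially] filterlim_add_const_nat_at_top)
  have "\<exists>p q. p \<in> {0<..<d n} \<times> {0<..<d n} \<and> q \<in> {0<..<d n} \<times> {0<..<d n} \<and>
      (case p of (s, e) \<Rightarrow> hse s e) = (case q of (s, e) \<Rightarrow> hes s e)" for n
  proof -
    obtain s e where 1: "s \<in> {0<..<d n}" "e \<in> {0<..<d n}"
      "h (d n) (d n) - h 0 (d n) - h (d n) 0 + h 0 0 = d n * d n * hse s e"
      using second_difference_mean_value[OF d ds dse] by metis
    obtain e' s' where 2: "e' \<in> {0<..<d n}" "s' \<in> {0<..<d n}"
      "h (d n) (d n) - h (d n) 0 - h 0 (d n) + h 0 0 = d n * d n * hes s' e'"
      using second_difference_mean_value[OF d[of n],
          where h = "\<lambda>e s. h s e" and hs = "\<lambda>e s. he s e" and hse = "\<lambda>e s. hes s e"] de des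
      by metis
    have "d n * d n * hse s e = d n * d n * hes s' e'"
      using 1(3) 2(3) by linarith
    then have "hse s e = hes s' e'"
      using d(1)[of n] by simp
    then show ?thesis using 1 2 by (intro exI[of _ "(s, e)"] exI[of _ "(s', e')"]) auto
  qed
  then obtain p q where p: "\<And>n. p n \<in> {0<..<d n} \<times> {0<..<d n}"
    and q: "\<And>n. q n \<in> {0<..<d n} \<times> {0<..<d n}"
    and eq: "\<And>n. (case p n of (s, e) \<Rightarrow> hse s e) = (case q n of (s, e) \<Rightarrow> hes s e)"
    by metis
  have lim: "(\<lambda>n. (case P n of (s, e) \<Rightarrow> g s e)) \<longlonglongrightarrow> g 0 0"
    if P: "\<And>n. P n \<in> {0<..<d n} \<times> {0<..<d n}"
      and g: "continuous_on ({0..<r} \<times> {0..<r}) (\<lambda>(s, e). g s e)"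
    for P :: "nat \<Rightarrow> real \<times> real" and g :: "real \<Rightarrow> real \<Rightarrow> real"
  proof -
    have bd: "0 < fst (P n)" "fst (P n) < d n" "0 < snd (P n)" "snd (P n) < d n" for n
      using P[of n] by (auto simp: mem_Times_iff)
    have "(\<lambda>n. fst (P n)) \<longlonglongrightarrow> 0"
      by (rule tendsto_sandwich[OF _ _ tendsto_const dlim]) (auto intro!: always_eventually less_imp_le bd)
    moreover have "(\<lambda>n. snd (P n)) \<longlonglongrightarrow> 0"
      by (rule tendsto_sandwich[OF _ _ tendsto_const dlim]) (auto intro!: always_eventually less_imp_le bd)
    ultimately have "(\<lambda>n. (fst (P n), snd (P n))) \<longlonglongrightarrow> (0, 0)"
      by (rule tendsto_Pair)
    then have "P \<longlonglongrightarrow> (0, 0)" by simp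
    moreover have "P n \<in> {0..<r} \<times> {0..<r}" for n
      using bd[of n] d[of n] by (auto simp: mem_Times_iff)
    ultimately have "(\<lambda>n. (\<lambda>(s, e). g s e) (P n)) \<longlonglongrightarrow> (\<lambda>(s, e). g s e) (0, 0)"
      using continuous_on_tendsto_compose[OF g, of P "(0,0)" sequentially] r by auto
    then show ?thesis by simp
  qed
  show ?thesis
    using LIMSEQ_unique[OF lim[OF p cse] lim[OF q ces, folded eq]] .
qed

lemma has_derivative_space_slice:
  assumes "open S" "x \<in> S" "e \<in> I" "(f has_derivative f') (at (x, e) within S \<times> I)"
  shows "((\<lambda>y. f (y, e)) has_derivative (\<lambda>u. f' (u, 0))) (at x)"
proof -
  have 1: "((\<lambda>y. (y, e)) has_derivative (\<lambda>u. (u, 0))) (at x within S)"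
    by (auto intro!: derivative_eq_intros)
  have "((\<lambda>y. f (y, e)) has_derivative (\<lambda>u. f' (u, 0))) (at x within S)"
    using has_derivative_in_compose[OF 1, of f f']
      has_derivative_subset[OF assms(4), of "(\<lambda>y. (y, e)) ` S"] assms(3) by blast
  then show ?thesis
    using at_within_open[OF assms(2,1)] by simp
qed

lemma has_vector_derivative_parameter_slice:
  assumes "x \<in> S" "e \<in> I" "(f has_derivative f') (at (x, e) within S \<times> I)"
  shows "((\<lambda>e. f (x, e)) has_vector_derivative f' (0, 1)) (at e within I)"
proof -
  have 1: "((\<lambda>e. (x, e)) has_derivative (\<lambda>y. (0, y))) (at e within I)"
    by (auto intro!: derivative_eq_intros)
  have "((\<lambda>e. f (x, e)) has_derivative (\<lambda>y. f' (0, y))) (at e within I)"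
    using has_derivative_in_compose[OF 1, of f f']
      has_derivative_subset[OF assms(3), of "(\<lambda>e. (x, e)) ` I"] assms(1) by blast
  moreover have "(\<lambda>y. f' (0, y)) = (\<lambda>y. y *\<^sub>R f' (0, 1))"
  proof
    show "f' (0, y) = y *\<^sub>R f' (0, 1)" for y
      using linear_scale[OF has_derivative_linear[OF assms(3)], of y "(0, 1)"]
      by (simp only: scaleR_Pair scaleR_zero_right real_scaleR_def mult_1_right)
  qed
  ultimately show ?thesis by (simp only: has_vector_derivative_def)
qed

text \<open>
  For a family over the half-open interval the parameter 0 is a boundary point, where the
  symmetry of second derivatives at interior points does not apply. Restricting to the two-parameter
  surface \<open>(s, e) \<mapsto> (x + s u, e)\<close> and testing against all vectors \<open>w\<close> reduces the claim to the
  corner of a square.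
\<close>

lemma mixed_derivatives_at_boundary:
  fixes f :: "'v::real_normed_vector \<times> real \<Rightarrow> 'w::real_inner"
  assumes S: "open S" "x \<in> S" and a: "0 < a" and f: "Ck_on 2 f (S \<times> {0..<a})"
  defines "D \<equiv> S \<times> {0..<a}"
  shows "frechet_derivative (\<lambda>p. frechet_derivative f (at p within D) (0, 1)) (at (x, 0) within D) (u, 0)
    = frechet_derivative (\<lambda>p. frechet_derivative f (at p within D) (u, 0)) (at (x, 0) within D) (0, 1)"
proof -
  define f1 where "f1 v = (\<lambda>p. frechet_derivative f (at p within D) v)" for v
  define f2 where "f2 v w = (\<lambda>p. frechet_derivative (f1 v) (at p within D) w)" for v w
  have fd: "(f has_derivative (\<lambda>v. f1 v p)) (at p within D)" if "p \<in> D" for p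
    using Ck_on_2_has_derivatives(1)[OF f[folded D_def] that] by (simp add: f1_def)
  have f1d: "(f1 v has_derivative (\<lambda>w. f2 v w p)) (at p within D)" if "p \<in> D" for p v
    using Ck_on_2_has_derivatives(2)[OF f[folded D_def] that, of v] by (simp add: f1_def f2_def)
  have f2c: "continuous_on D (f2 v w)" for v w
    using Ck_on_2_has_derivatives(3)[OF f[folded D_def], of v w] by (simp add: f1_def f2_def)
  have "open ((\<lambda>s. x + s *\<^sub>R u) -` S)"
    by (intro open_vimage S continuous_intros)
  moreover have "0 \<in> (\<lambda>s. x + s *\<^sub>R u) -` S"
    using S by simp
  ultimately obtain r0 where r0: "r0 > 0" "ball 0 r0 \<subseteq> (\<lambda>s. x + s *\<^sub>R u) -` S"
    by (rule openE)
  define r where "r = min r0 a"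
  have r: "0 < r" using r0 a by (simp add: r_def)
  define pt where "pt s e = (x + s *\<^sub>R u, e)" for s e :: real
  have pt: "pt s e \<in> D" if "s \<in> {0..<r}" "e \<in> {0..<r}" for s e
    using r0(2) that by (auto simp: pt_def D_def r_def subset_iff dist_norm)
  have ds: "((\<lambda>s. w \<bullet> g (pt s e)) has_real_derivative w \<bullet> g' (u, 0)) (at s within {0..<r})"
    if "s \<in> {0..<r}" "e \<in> {0..<r}" "(g has_derivative g') (at (pt s e) within D)" for s e w g' and g :: "'v \<times> real \<Rightarrow> 'w"
  proof -
    have 1: "((\<lambda>s. pt s e) has_derivative (\<lambda>y. (y *\<^sub>R u, 0))) (at s within {0..<r})"
      unfolding pt_def by (auto intro!: derivative_eq_intros)

    have "((\<lambda>s. g (pt s e)) has_derivative (\<lambda>y. g' (y *\<^sub>R u, 0))) (at s within {0..<r})"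
      using has_derivative_in_compose[OF 1, of g g']
        has_derivative_subset[OF that(3), of "(\<lambda>s. pt s e) ` {0..<r}"] pt that(2) by blast
    from has_derivative_inner_right[OF this, of w]
    show ?thesis
      using linear_scale[OF has_derivative_linear[OF that(3)], of _ "(u, 0)"]
      by (simp add: has_field_derivative_def mult_commute_abs)
  qed
  have de: "((\<lambda>e. w \<bullet> g (pt s e)) has_real_derivative w \<bullet> g' (0, 1)) (at e within {0..<r})"
    if "s \<in> {0..<r}" "e \<in> {0..<r}" "(g has_derivative g') (at (pt s e) within D)" for s e w g' and g :: "'v \<times> real \<Rightarrow> 'w"
  proof -
    have "((\<lambda>e. g (pt s e)) has_vector_derivative g' (0, 1)) (at e within {0..<a})"
      using has_vector_derivative_parameter_slice[OF _ _ that(3)[unfolded pt_def D_def]]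
        pt[OF that(1,2)] by (auto simp: pt_def D_def)
    then have "((\<lambda>e. g (pt s e)) has_vector_derivative g' (0, 1)) (at e within {0..<r})"
      by (rule has_vector_derivative_within_subset) (auto simp: r_def)
    then show ?thesis
      unfolding has_real_derivative_iff_has_vector_derivative
      by (rule bounded_linear.has_vector_derivative[OF bounded_linear_inner_right])
  qed
  have cont: "continuous_on ({0..<r} \<times> {0..<r}) (\<lambda>(s, e). w \<bullet> f2 v v' (pt s e))" for v v' w
  proof -
    have "continuous_on ({0..<r} \<times> {0..<r}) (\<lambda>z. w \<bullet> f2 v v' (pt (fst z) (snd z)))"
      by (intro continuous_intros continuous_on_compose2[OF f2c[of v v']])
        (use pt in \<open>auto simp: pt_def[abs_def] intro!: continuous_intros\<close>)
    then show ?thesis by (simp add: case_prod_beta')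
  qed
  have "w \<bullet> f2 (u, 0) (0, 1) (pt 0 0) = w \<bullet> f2 (0, 1) (u, 0) (pt 0 0)" for w
    by (rule mixed_partials_at_corner[OF r, where h = "\<lambda>s e. w \<bullet> f (pt s e)"
          and hs = "\<lambda>s e. w \<bullet> f1 (u, 0) (pt s e)" and he = "\<lambda>s e. w \<bullet> f1 (0, 1) (pt s e)"
          and hse = "\<lambda>s e. w \<bullet> f2 (u, 0) (0, 1) (pt s e)" and hes = "\<lambda>s e. w \<bullet> f2 (0, 1) (u, 0) (pt s e)"])
      (rule ds[OF _ _ fd[OF pt]] de[OF _ _ fd[OF pt]] ds[OF _ _ f1d[OF pt]] de[OF _ _ f1d[OF pt]] cont
        | assumption)+
  then have "f2 (0, 1) (u, 0) (pt 0 0) = f2 (u, 0) (0, 1) (pt 0 0)"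
    by (intro vector_eq_ldot[THEN iffD1]) simp
  then show ?thesis by (simp add: f2_def f1_def[abs_def] pt_def)
qed

section \<open>One-sided derivatives in the parameter\<close>

lemma at_within_Ico_at_right:
  fixes a b :: "'a::linorder_topology"
  assumes "a < b"
  shows "at a within {a..<b} = at_right a"
  by (rule at_within_nhd[of _ "{..<b}"]) (use assms in auto)

text \<open>
  A product rule for \<open>L e (w e)\<close>, where \<open>L e\<close> is only differentiated at fixed arguments. In finite
  dimension this suffices: expand \<open>w e\<close> in a basis.
\<close>

lemma has_vector_derivative_linear_family_apply:
  fixes L :: "real \<Rightarrow> 'v::euclidean_space \<Rightarrow> 'w::real_normed_vector"
  assumes lin: "\<And>e. e \<in> I \<Longrightarrow> linear (L e)" "linear L'" and t: "t \<in> I"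
    and L: "\<And>u. ((\<lambda>e. L e u) has_vector_derivative L' u) (at t within I)"
    and w: "(w has_vector_derivative w') (at t within I)"
  shows "((\<lambda>e. L e (w e)) has_vector_derivative L t w' + L' (w t)) (at t within I)"
proof -
  have expand: "l v = (\<Sum>b\<in>Basis. (v \<bullet> b) *\<^sub>R l b)" if "linear l" for l :: "'v \<Rightarrow> 'w" and v
    by (subst (1) euclidean_representation[symmetric, of v])
      (simp add: linear_sum[OF that] linear_scale[OF that])
  have wb: "((\<lambda>e. w e \<bullet> b) has_real_derivative w' \<bullet> b) (at t within I)" for b
    using has_derivative_inner_left[OF w[unfolded has_vector_derivative_def], of b]
    by (simp add: has_field_derivative_def mult_commute_abs)
  have "((\<lambda>e. \<Sum>b\<in>Basis. (w e \<bullet> b) *\<^sub>R L e b) has_vector_derivative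
      (\<Sum>b\<in>Basis. (w t \<bullet> b) *\<^sub>R L' b + (w' \<bullet> b) *\<^sub>R L t b)) (at t within I)"
    by (intro has_vector_derivative_sum has_vector_derivative_scaleR wb L)
  also have "(\<Sum>b\<in>Basis. (w t \<bullet> b) *\<^sub>R L' b + (w' \<bullet> b) *\<^sub>R L t b) = L t w' + L' (w t)"
    by (simp add: sum.distrib expand[OF lin(1)[OF t], of w'] expand[OF lin(2), of "w t"])
  finally show ?thesis
    by (rule has_vector_derivative_transform[OF t, rotated]) (simp add: expand lin)
qed

lemma Ck_on_slice_derivatives:
  fixes f :: "'v::real_normed_vector \<times> real \<Rightarrow> 'w::real_inner"
  assumes S: "open S" "x \<in> S" and a: "0 < a" and f: "Ck_on 2 f (S \<times> {0..<a})"
  shows "\<And>e. e \<in> {0..<a} \<Longrightarrow> (\<lambda>y. f (y, e)) differentiable at x"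
    and "((\<lambda>e. f (x, e)) has_vector_derivative vector_derivative (\<lambda>e. f (x, e)) (at_right 0))
      (at_right 0)"
proof -
  have fd: "(f has_derivative frechet_derivative f (at (x, e) within S \<times> {0..<a}))
      (at (x, e) within S \<times> {0..<a})" if "e \<in> {0..<a}" for e
    using Ck_on_2_has_derivatives(1)[OF f, of "(x, e)"] S that by simp
  show "(\<lambda>y. f (y, e)) differentiable at x" if "e \<in> {0..<a}" for e
    using has_derivative_space_slice[OF S that fd[OF that]] by (auto simp: differentiable_def)
  have "((\<lambda>e. f (x, e)) has_vector_derivative frechet_derivative f (at (x, 0) within S \<times> {0..<a}) (0, 1))
      (at_right 0)"
    using has_vector_derivative_parameter_slice[OF S(2) _ fd, of 0] a
    by (simp add: at_within_Ico_at_right)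
  then show "((\<lambda>e. f (x, e)) has_vector_derivative vector_derivative (\<lambda>e. f (x, e)) (at_right 0))
      (at_right 0)"
    by (meson differentiableI_vector vector_derivative_works)
qed

text \<open>
  Differentiation in the parameter at 0 commutes with differentiation in space. This is what allows
  an identity between space derivatives, such as the vanishing of a Lie bracket, to be differentiated
  with respect to the parameter.
\<close>

lemma derivative_of_parameter_derivative:
  fixes f :: "'v::real_normed_vector \<times> real \<Rightarrow> 'w::real_inner"
  assumes S: "open S" "x \<in> S" and a: "0 < a" and f: "Ck_on 2 f (S \<times> {0..<a})"
    and f1: "\<And>y. y \<in> S \<Longrightarrow> ((\<lambda>e. f (y, e)) has_vector_derivative f1 y) (at_right 0)"
  shows "f1 differentiable at x"
    and "((\<lambda>e. frechet_derivative (\<lambda>y. f (y, e)) (at x) u) has_vector_derivative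
      frechet_derivative f1 (at x) u) (at_right 0)"
proof -
  define D where "D = S \<times> {0..<a}"
  define d1 where "d1 v = (\<lambda>p. frechet_derivative f (at p within D) v)" for v
  have fd: "(f has_derivative (\<lambda>v. d1 v p)) (at p within D)" if "p \<in> D" for p
    using Ck_on_2_has_derivatives(1)[OF f[folded D_def] that] by (simp add: d1_def)
  have d1d: "(d1 v has_derivative frechet_derivative (d1 v) (at p within D)) (at p within D)"
    if "p \<in> D" for p v
    using Ck_on_2_has_derivatives(2)[OF f[folded D_def] that, of v] by (simp add: d1_def)
  have f1_eq: "f1 y = d1 (0, 1) (y, 0)" if "y \<in> S" for y
  proof -
    have "((\<lambda>e. f (y, e)) has_vector_derivative d1 (0, 1) (y, 0)) (at_right 0)"
      using has_vector_derivative_parameter_slice[OF that _ fd[unfolded D_def], of 0] a that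
      by (simp add: at_within_Ico_at_right)
    with f1[OF that] show ?thesis
      by (intro vector_derivative_unique_within[of 0 "{0<..}"]) auto
  qed
  have "((\<lambda>y. d1 (0, 1) (y, 0)) has_derivative
      (\<lambda>u. frechet_derivative (d1 (0, 1)) (at (x, 0) within D) (u, 0))) (at x)"
    using has_derivative_space_slice[OF S _ d1d[unfolded D_def], of 0] S a
    by (simp add: D_def)
  then have f1d: "(f1 has_derivative
      (\<lambda>u. frechet_derivative (d1 (0, 1)) (at (x, 0) within D) (u, 0))) (at x)"
    by (rule has_derivative_transform_within_open[OF _ S]) (simp add: f1_eq)
  then show "f1 differentiable at x"
    by (auto simp: differentiable_def)
  have slice: "frechet_derivative (\<lambda>y. f (y, e)) (at x) u = d1 (u, 0) (x, e)" if "e \<in> {0..<a}" for e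
    using frechet_derivative_at[OF has_derivative_space_slice[OF S that fd[unfolded D_def]]] S that
    by (metis mem_Times_iff fst_conv snd_conv)
  have "((\<lambda>e. d1 (u, 0) (x, e)) has_vector_derivative
      frechet_derivative (d1 (u, 0)) (at (x, 0) within D) (0, 1)) (at 0 within {0..<a})"
    using has_vector_derivative_parameter_slice[OF S(2) _ d1d[unfolded D_def], of 0] S a
    by (simp add: D_def)
  also have "frechet_derivative (d1 (u, 0)) (at (x, 0) within D) (0, 1)
      = frechet_derivative (d1 (0, 1)) (at (x, 0) within D) (u, 0)"
    using mixed_derivatives_at_boundary[OF S a f] by (simp add: D_def d1_def[abs_def])
  also have "\<dots> = frechet_derivative f1 (at x) u"
    using frechet_derivative_at[OF f1d] by metis
  finally have "((\<lambda>e. frechet_derivative (\<lambda>y. f (y, e)) (at x) u) has_vector_derivative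
      frechet_derivative f1 (at x) u) (at 0 within {0..<a})"
    by (rule has_vector_derivative_transform[rotated 2]) (use a in \<open>auto simp: slice\<close>)
  then show "((\<lambda>e. frechet_derivative (\<lambda>y. f (y, e)) (at x) u) has_vector_derivative
      frechet_derivative f1 (at x) u) (at_right 0)"
    using a by (simp add: at_within_Ico_at_right)
qed

text \<open>
  A pointwise expansion with quadratic remainder says nothing at the parameter 0 itself and does not
  mention derivatives; for a family that is differentiable from the right at 0 it determines
  both the value at 0 and the derivative there.
\<close>

lemma first_order_expansion_at_right:
  fixes f :: "real \<Rightarrow> 'w::real_normed_vector"
  assumes f: "(f has_vector_derivative v) (at_right 0)"
    and exp: "(\<lambda>\<epsilon>. norm (f \<epsilon> - (a + \<epsilon> *\<^sub>R b))) \<in> O[at_right 0](\<lambda>\<epsilon>. \<epsilon>\<^sup>2)"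
  shows "f 0 = a" "v = b"
proof -
  obtain c where c: "\<forall>\<^sub>F \<epsilon> in at_right 0. norm (norm (f \<epsilon> - (a + \<epsilon> *\<^sub>R b))) \<le> c * norm (\<epsilon>\<^sup>2)"
    using landau_o.bigE[OF exp] by blast
  have cont: "(f \<longlongrightarrow> f 0) (at_right 0)"
    using has_vector_derivative_continuous[OF f] by (simp add: continuous_within)
  have "((\<lambda>\<epsilon>. f \<epsilon> - (a + \<epsilon> *\<^sub>R b)) \<longlongrightarrow> f 0 - (a + 0 *\<^sub>R b)) (at_right 0)"
    by (intro tendsto_intros cont)
  moreover have "((\<lambda>\<epsilon>. f \<epsilon> - (a + \<epsilon> *\<^sub>R b)) \<longlongrightarrow> 0) (at_right 0)"
  proof (rule Lim_null_comparison)
    show "\<forall>\<^sub>F \<epsilon> in at_right 0. norm (f \<epsilon> - (a + \<epsilon> *\<^sub>R b)) \<le> c * \<epsilon>\<^sup>2"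
      using c by simp
    have "((\<lambda>\<epsilon>. c * \<epsilon>\<^sup>2) \<longlongrightarrow> c * 0\<^sup>2) (at_right 0)"
      by (intro tendsto_intros)
    then show "((\<lambda>\<epsilon>. c * \<epsilon>\<^sup>2) \<longlongrightarrow> 0) (at_right 0)" by simp
  qed
  ultimately have "f 0 - (a + 0 *\<^sub>R b) = 0"
    by (rule tendsto_unique[OF trivial_limit_at_right_real])
  then show f0: "f 0 = a" by simp
  have "(f has_vector_derivative b) (at_right 0)"
    unfolding has_vector_derivative_def has_derivative_within
  proof (rule conjI[OF bounded_linear_scaleR_left], rule Lim_null_comparison)
    have "\<forall>\<^sub>F \<epsilon> in at_right 0. 0 < (\<epsilon>::real)"
      by (simp add: eventually_at_right_less)
    with c show "\<forall>\<^sub>F \<epsilon> in at_right 0.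
        norm ((1 / norm (\<epsilon> - 0)) *\<^sub>R (f \<epsilon> - (f 0 + (\<epsilon> - 0) *\<^sub>R b))) \<le> c * \<epsilon>"
    proof eventually_elim
      case (elim \<epsilon>)
      then have "norm (f \<epsilon> - (a + \<epsilon> *\<^sub>R b)) / \<epsilon> \<le> c * \<epsilon>"
        by (simp add: pos_divide_le_eq power2_eq_square mult.assoc)
      with elim show ?case by (simp add: f0)
    qed
    have "((\<lambda>\<epsilon>. c * \<epsilon>) \<longlongrightarrow> c * 0) (at_right 0)"
      by (intro tendsto_intros)
    then show "((\<lambda>\<epsilon>. c * \<epsilon>) \<longlongrightarrow> 0) (at_right 0)" by simp
  qed
  with f show "v = b"
    by (intro vector_derivative_unique_within[of 0 "{0<..}"]) auto
qed

section \<open>First variation of commuting families in a vector space\<close>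

text \<open>
  The equation \<open>Dg \<cdot> f = Df \<cdot> g\<close> holds for all small parameters; both sides are differentiated at the
  parameter 0 by the product rule. The result is the equation \<open>[f, g1] + [f1, g] = 0\<close>
  between the fields at parameter 0 and their first variations.
\<close>

lemma first_variation_of_commuting_families:
  fixes f g :: "'v::euclidean_space \<times> real \<Rightarrow> 'v"
  assumes f: "open S" "x \<in> S" "0 < a" "Ck_on 2 f (S \<times> {0..<a})"
      "\<And>y. y \<in> S \<Longrightarrow> ((\<lambda>e. f (y, e)) has_vector_derivative f1 y) (at_right 0)"
    and g: "open R" "x \<in> R" "0 < b" "Ck_on 2 g (R \<times> {0..<b})"
      "\<And>y. y \<in> R \<Longrightarrow> ((\<lambda>e. g (y, e)) has_vector_derivative g1 y) (at_right 0)"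
    and comm: "0 < c" "\<And>e. e \<in> {0..<c} \<Longrightarrow>
      frechet_derivative (\<lambda>y. g (y, e)) (at x) (f (x, e))
      = frechet_derivative (\<lambda>y. f (y, e)) (at x) (g (x, e))"
  shows "frechet_derivative (\<lambda>y. g (y, 0)) (at x) (f1 x) + frechet_derivative g1 (at x) (f (x, 0))
    = frechet_derivative (\<lambda>y. f (y, 0)) (at x) (g1 x) + frechet_derivative f1 (at x) (g (x, 0))"
proof -
  \<comment> \<open>on the common interval both families and the commutation relation are available\<close>
  define k where "k = min c (min a b)"
  have k: "0 < k" "k \<le> c" "k \<le> a" "k \<le> b" using f g comm by (auto simp: k_def)
  have atk: "at 0 within {0..<k} = at_right 0" using k by (simp add: at_within_Ico_at_right)
  have product: "((\<lambda>e. frechet_derivative (\<lambda>y. q (y, e)) (at x) (p (x, e))) has_vector_derivative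
      frechet_derivative (\<lambda>y. q (y, 0)) (at x) p' + frechet_derivative q' (at x) (p (x, 0)))
      (at 0 within {0..<k})"
    if q: "open W" "x \<in> W" "0 < l" "k \<le> l" "Ck_on 2 q (W \<times> {0..<l})"
      "\<And>y. y \<in> W \<Longrightarrow> ((\<lambda>e. q (y, e)) has_vector_derivative q' y) (at_right 0)"
    and p: "((\<lambda>e. p (x, e)) has_vector_derivative p') (at_right 0)"
  for p q :: "'v \<times> real \<Rightarrow> 'v" and p' q' W l
  proof (rule has_vector_derivative_linear_family_apply)
    show "linear (frechet_derivative (\<lambda>y. q (y, e)) (at x))" if "e \<in> {0..<k}" for e
      using Ck_on_slice_derivatives(1)[OF q(1,2,3,5), of e] that q(4)
      by (intro linear_frechet_derivative) auto
    show "linear (frechet_derivative q' (at x))"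
      by (intro linear_frechet_derivative derivative_of_parameter_derivative(1)[OF q(1,2,3,5,6)])
    show "((\<lambda>e. frechet_derivative (\<lambda>y. q (y, e)) (at x) u) has_vector_derivative
        frechet_derivative q' (at x) u) (at 0 within {0..<k})" for u
      unfolding atk by (rule derivative_of_parameter_derivative(2)[OF q(1,2,3,5,6)])
  qed (use k p in \<open>auto simp: atk\<close>)
  have "((\<lambda>e. frechet_derivative (\<lambda>y. f (y, e)) (at x) (g (x, e))) has_vector_derivative
      frechet_derivative (\<lambda>y. g (y, 0)) (at x) (f1 x) + frechet_derivative g1 (at x) (f (x, 0)))
      (at 0 within {0..<k})"
    by (rule has_vector_derivative_transform[OF _ _ product[where q = g and p = f and p' = "f1 x" and q' = g1, OF g(1,2,3) k(4) g(4,5) f(5)[OF f(2)]]])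
      (use k comm(2) in auto)
  moreover have "((\<lambda>e. frechet_derivative (\<lambda>y. f (y, e)) (at x) (g (x, e))) has_vector_derivative
      frechet_derivative (\<lambda>y. f (y, 0)) (at x) (g1 x) + frechet_derivative f1 (at x) (g (x, 0)))
      (at 0 within {0..<k})"
    by (rule product[where q = f and p = g and p' = "g1 x" and q' = f1, OF f(1,2,3) k(3) f(4,5) g(5)[OF g(2)]])
  ultimately show ?thesis
    by (intro vector_derivative_unique_within[of 0 "{0..<k}"]) (auto simp: atk)
qed

section \<open>Lie brackets and families of vector fields in charts\<close>

text \<open>
  \<^term>\<open>frechet_derivative\<close> selects from the set of all derivatives at \<open>x\<close>, and this set is the same
  for two functions that agree near \<open>x\<close>, even when it is empty.
\<close>

lemma frechet_derivative_cong_open: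
  assumes W: "open W" "x \<in> W" and eq: "\<And>y. y \<in> W \<Longrightarrow> f y = g y"
  shows "frechet_derivative f (at x) = frechet_derivative g (at x)"
proof -
  have "(f has_derivative f') (at x) \<longleftrightarrow> (g has_derivative f') (at x)" for f'
    using has_derivative_transform_within_open[OF _ W, of f f' UNIV g]
      has_derivative_transform_within_open[OF _ W, of g f' UNIV f] eq by auto
  then show ?thesis by (simp add: frechet_derivative_def)
qed

lemma
  assumes M: "oriented_Ck_manifold k M A" and c: "c \<in> A"
  shows openin_chart_domain: "openin M (fst c)"
    and chart_inv_chart: "\<And>p. p \<in> fst c \<Longrightarrow> chart_inv c (snd c p) = p"
    and open_chart_image: "\<And>W. openin M W \<Longrightarrow> open (snd c ` (fst c \<inter> W))"
proof -
  have hom: "homeomorphic_map (subtopology M (fst c)) (top_of_set (snd c ` fst c)) (snd c)"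
    and op: "open (snd c ` fst c)" and oc: "openin M (fst c)"
    using M c unfolding oriented_Ck_manifold_def is_chart_def by auto
  show "openin M (fst c)" by (rule oc)
  have "inj_on (snd c) (fst c)"
    using homeomorphic_imp_injective_map[OF hom] openin_subset[OF oc] by (simp add: Int_absorb1)
  then show "chart_inv c (snd c p) = p" if "p \<in> fst c" for p
    using that by (simp add: chart_inv_def)
  show "open (snd c ` (fst c \<inter> W))" if "openin M W" for W
  proof -
    have "openin (subtopology M (fst c)) (fst c \<inter> W)"
      using that by (simp add: openin_subtopology_Int2)
    then have "openin (top_of_set (snd c ` fst c)) (snd c ` (fst c \<inter> W))"
      using homeomorphic_imp_open_map[OF hom] unfolding open_map_def by blast
    then show ?thesis using op openin_open_trans by blast
  qed
qed

lemma coord_chart: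
  assumes "oriented_Ck_manifold k M A" "c \<in> A" "p \<in> fst c"
  shows "coord c X (snd c p) = X p c"
  using chart_inv_chart[OF assms] by (simp add: coord_def)

lemma lie_bracket_cong:
  assumes M: "oriented_Ck_manifold k M A" and W: "openin M W" "p \<in> W"
    and eq: "\<And>q c. q \<in> W \<Longrightarrow> c \<in> A \<Longrightarrow> q \<in> fst c \<Longrightarrow> X q c = X' q c"
      "\<And>q c. q \<in> W \<Longrightarrow> c \<in> A \<Longrightarrow> q \<in> fst c \<Longrightarrow> Y q c = Y' q c"
  shows "lie_bracket A X Y p = lie_bracket A X' Y' p"
proof
  fix c
  show "lie_bracket A X Y p c = lie_bracket A X' Y' p c"
  proof (cases "c \<in> A \<and> p \<in> fst c")
    case True
    then have c: "c \<in> A" "p \<in> fst c" by auto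
    have x: "snd c p \<in> snd c ` (fst c \<inter> W)" using c W by blast
    have coords: "coord c F y = coord c F' y"
      if "y \<in> snd c ` (fst c \<inter> W)" "\<And>q. q \<in> W \<Longrightarrow> q \<in> fst c \<Longrightarrow> F q c = F' q c" for F F' y
      using that by (elim imageE) (simp add: coord_chart[OF M c(1)])
    have "frechet_derivative (coord c X) (at (snd c p)) = frechet_derivative (coord c X') (at (snd c p))"
      by (rule frechet_derivative_cong_open[OF open_chart_image[OF M c(1) W(1)] x coords])
        (use eq(1) c(1) in blast)+
    moreover have "frechet_derivative (coord c Y) (at (snd c p)) = frechet_derivative (coord c Y') (at (snd c p))"
      by (rule frechet_derivative_cong_open[OF open_chart_image[OF M c(1) W(1)] x coords])
        (use eq(2) c(1) in blast)+
    ultimately show ?thesis using eq W c by (simp add: lie_bracket_def)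
  qed (auto simp: lie_bracket_def)
qed

text \<open>
  The change of charts is a fixed linear map on the tangent space at \<open>p\<close>, so the transformation law
  passes from the vectors \<open>Y e\<close> to their derivative in \<open>e\<close>.
\<close>

lemma tangent_space_parameter_derivative:
  assumes M: "oriented_Ck_manifold (Suc k) M A" and b: "0 < b"
    and Y: "\<And>e. e \<in> {0..<b} \<Longrightarrow> Y e \<in> tangent_space A p"
    and Y1: "\<And>c. c \<in> A \<Longrightarrow> p \<in> fst c \<Longrightarrow> ((\<lambda>e. Y e c) has_vector_derivative Y1 c) (at_right 0)"
      "\<And>c. \<not> (c \<in> A \<and> p \<in> fst c) \<Longrightarrow> Y1 c = 0"
  shows "Y1 \<in> tangent_space A p"
  unfolding tangent_space_def mem_Collect_eq
proof (intro conjI allI impI ballI)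
  fix c d assume c: "c \<in> A" and d: "d \<in> A" and p: "p \<in> fst c \<inter> fst d"
  define L where "L = frechet_derivative (transition c d) (at (snd c p))"
  have "transition c d differentiable_on snd c ` (fst c \<inter> fst d)"
    using M c d unfolding oriented_Ck_manifold_def Ck_on.simps by blast
  then have "transition c d differentiable at (snd c p)"
    using p differentiable_on_eq_differentiable_at[OF
        open_chart_image[OF M c openin_chart_domain[OF M d]]] by blast
  then have "bounded_linear L"
    unfolding L_def frechet_derivative_works by (rule has_derivative_bounded_linear)
  moreover have "((\<lambda>e. Y e c) has_vector_derivative Y1 c) (at_right 0)"
    using Y1(1)[OF c] p by simp
  ultimately have 1: "((\<lambda>e. L (Y e c)) has_vector_derivative L (Y1 c)) (at_right 0)"
    by (rule bounded_linear.has_vector_derivative)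
  have at: "at_right 0 = at 0 within {0..<b}"
    using b by (simp add: at_within_Ico_at_right)
  have "Y e d = L (Y e c)" if "e \<in> {0..<b}" for e
    using Y[OF that] c d p unfolding tangent_space_def mem_Collect_eq L_def by blast
  then have "((\<lambda>e. Y e d) has_vector_derivative L (Y1 c)) (at_right 0)"
    unfolding at
    by (intro has_vector_derivative_transform[OF _ _ 1[unfolded at]]) (use b in simp_all)
  with Y1(1)[OF d] p have "Y1 d = L (Y1 c)"
    by (intro vector_derivative_unique_within[of 0 "{0<..}"]) auto
  then show "Y1 d = frechet_derivative (transition c d) (at (snd c p)) (Y1 c)"
    by (simp add: L_def)
qed (rule Y1(2))

lemma commuting_families_first_variation:
  assumes M: "oriented_Ck_manifold k M A"
    and X: "openin M U" "p \<in> U" "0 < a" "Ck_vector_field_family 2 A U {0..<a} X"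
      "\<And>q c. q \<in> U \<Longrightarrow> c \<in> A \<Longrightarrow> q \<in> fst c \<Longrightarrow>
        ((\<lambda>e. X e q c) has_vector_derivative X1 q c) (at_right 0)"
    and Z: "openin M V" "p \<in> V" "0 < b" "Ck_vector_field_family 2 A V {0..<b} Z"
      "\<And>q c. q \<in> V \<Longrightarrow> c \<in> A \<Longrightarrow> q \<in> fst c \<Longrightarrow>
        ((\<lambda>e. Z e q c) has_vector_derivative Z1 q c) (at_right 0)"
    and comm: "0 < r" "\<And>e. e \<in> {0..<r} \<Longrightarrow> lie_bracket A (X e) (Z e) p = (\<lambda>_. 0)"
  shows "lie_bracket A (X 0) Z1 p = (\<lambda>c. - lie_bracket A X1 (Z 0) p c)"
proof
  fix c
  show "lie_bracket A (X 0) Z1 p c = - lie_bracket A X1 (Z 0) p c"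
  proof (cases "c \<in> A \<and> p \<in> fst c")
    case True
    then have c: "c \<in> A" "p \<in> fst c" by auto
    let ?x = "snd c p"
    have S: "open (snd c ` (fst c \<inter> U))" "?x \<in> snd c ` (fst c \<inter> U)"
      and R: "open (snd c ` (fst c \<inter> V))" "?x \<in> snd c ` (fst c \<inter> V)"
      using open_chart_image[OF M c(1)] c X(1,2) Z(1,2) by auto
    have X_smooth: "Ck_on 2 (\<lambda>(y, e). coord c (X e) y) (snd c ` (fst c \<inter> U) \<times> {0..<a})"
      and Z_smooth: "Ck_on 2 (\<lambda>(y, e). coord c (Z e) y) (snd c ` (fst c \<inter> V) \<times> {0..<b})"
      using X(4) Z(4) c unfolding Ck_vector_field_family_def by blast+
    have X_param: "((\<lambda>e. case (y, e) of (y, e) \<Rightarrow> coord c (X e) y) has_vector_derivative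
        coord c X1 y) (at_right 0)" if "y \<in> snd c ` (fst c \<inter> U)" for y
      using that X(5)[OF _ c(1)] by (elim imageE) (simp add: coord_chart[OF M c(1)])
    have Z_param: "((\<lambda>e. case (y, e) of (y, e) \<Rightarrow> coord c (Z e) y) has_vector_derivative
        coord c Z1 y) (at_right 0)" if "y \<in> snd c ` (fst c \<inter> V)" for y
      using that Z(5)[OF _ c(1)] by (elim imageE) (simp add: coord_chart[OF M c(1)])
    have "frechet_derivative (coord c (Z e)) (at ?x) (coord c (X e) ?x)
        = frechet_derivative (coord c (X e)) (at ?x) (coord c (Z e) ?x)" if "e \<in> {0..<r}" for e
      using fun_cong[OF comm(2)[OF that], of c] c by (simp add: lie_bracket_def coord_chart[OF M])
    then have "frechet_derivative (coord c (Z 0)) (at ?x) (X1 p c) + frechet_derivative (coord c Z1) (at ?x) (X 0 p c)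
        = frechet_derivative (coord c (X 0)) (at ?x) (Z1 p c) + frechet_derivative (coord c X1) (at ?x) (Z 0 p c)"
      using first_variation_of_commuting_families[OF S X(3) X_smooth X_param R Z(3) Z_smooth Z_param comm(1)]
        c by (simp add: coord_chart[OF M])
    then show ?thesis
      using c by (simp add: lie_bracket_def algebra_simps)
  qed (auto simp: lie_bracket_def)
qed

section \<open>Pairing with solutions of the adjoint variational equation\<close>

text \<open>
  In a chart \<open>\<omega>' = - (DX)\<^sup>T \<omega>\<close> and \<open>(Y \<circ> \<gamma>)' = DY X\<close>, whence \<open>(\<omega> \<bullet> Y)' = \<omega> \<bullet> (DY X - DX Y)\<close>.
  The two terms with opposite signs form the bracket: the solutions of the adjoint equation are
  transported by the flow so that only the change of \<open>Y\<close> relative to the flow remains.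
\<close>

lemma adjoint_variational_pairing_derivative:
  assumes M: "oriented_Ck_manifold k M A" and curve: "integral_curve M A X \<gamma>"
    and AVE: "satisfies_AVE M A X \<gamma> \<omega>"
    and W: "openin M W" "\<gamma> t \<in> W" and Y: "vector_field A W Y"
    and diff: "\<And>c. c \<in> A \<Longrightarrow> \<gamma> t \<in> fst c \<Longrightarrow> coord c X differentiable at (snd c (\<gamma> t))"
      "\<And>c. c \<in> A \<Longrightarrow> \<gamma> t \<in> fst c \<Longrightarrow> coord c Y differentiable at (snd c (\<gamma> t))"
  shows "((\<lambda>s. pairing A (\<gamma> s) (\<omega> (\<gamma> s)) (Y (\<gamma> s))) has_vector_derivative
      pairing A (\<gamma> t) (\<omega> (\<gamma> t)) (lie_bracket A X Y (\<gamma> t))) (at t)"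
proof -
  \<comment> \<open>the chart in which the pairing at \<open>\<gamma> t\<close> is evaluated by definition; the computation stays in this chart near \<open>t\<close>\<close>
  define c where "c = (SOME c. c \<in> A \<and> \<gamma> t \<in> fst c)"
  have cont: "continuous_map euclideanreal M \<gamma>"
    using curve by (simp add: integral_curve_def)
  have "\<gamma> t \<in> (\<Union>c\<in>A. fst c)"
    using M openin_subset[OF W(1)] W(2) unfolding oriented_Ck_manifold_def by auto
  then have "\<exists>c. c \<in> A \<and> \<gamma> t \<in> fst c" by blast
  then have "c \<in> A \<and> \<gamma> t \<in> fst c"
    unfolding c_def by (rule someI_ex)
  then have c: "c \<in> A" "\<gamma> t \<in> fst c" by simp_all
  let ?DX = "frechet_derivative (coord c X) (at (snd c (\<gamma> t)))"
  let ?DY = "frechet_derivative (coord c Y) (at (snd c (\<gamma> t)))"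
  have velocity: "((\<lambda>s. snd c (\<gamma> s)) has_vector_derivative X (\<gamma> t) c) (at t)"
    using curve c unfolding integral_curve_def by blast
  have "(coord c Y has_derivative ?DY) (at (snd c (\<gamma> t)))"
    using diff(2)[OF c] by (simp add: frechet_derivative_works)
  from vector_derivative_diff_chain_within[OF velocity has_derivative_at_withinI[OF this]]
  have "((\<lambda>s. coord c Y (snd c (\<gamma> s))) has_vector_derivative ?DY (X (\<gamma> t) c)) (at t)"
    by (simp add: o_def)
  from bounded_bilinear.has_vector_derivative[OF bounded_bilinear_inner
      satisfies_AVE_coord[OF M curve AVE c] this]
  have "((\<lambda>s. \<omega> (\<gamma> s) c \<bullet> coord c Y (snd c (\<gamma> s))) has_vector_derivative
      \<omega> (\<gamma> t) c \<bullet> ?DY (X (\<gamma> t) c) + (- adjoint ?DX (\<omega> (\<gamma> t) c)) \<bullet> Y (\<gamma> t) c) (at t)"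
    by (simp add: coord_chart[OF M c])
  also have "\<omega> (\<gamma> t) c \<bullet> ?DY (X (\<gamma> t) c) + (- adjoint ?DX (\<omega> (\<gamma> t) c)) \<bullet> Y (\<gamma> t) c
      = \<omega> (\<gamma> t) c \<bullet> lie_bracket A X Y (\<gamma> t) c"
    using adjoint_works[OF linear_frechet_derivative[OF diff(1)[OF c]], of "Y (\<gamma> t) c" "\<omega> (\<gamma> t) c"] c
    by (simp add: lie_bracket_def inner_diff_right inner_commute)
  also have "\<dots> = pairing A (\<gamma> t) (\<omega> (\<gamma> t)) (lie_bracket A X Y (\<gamma> t))"
    by (simp add: pairing_def c_def Let_def)
  finally show ?thesis
  proof (rule has_vector_derivative_transform_within_open)
    have "openin euclideanreal {s \<in> topspace euclideanreal. \<gamma> s \<in> fst c \<inter> W}"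
      using cont openin_Int[OF openin_chart_domain[OF M c(1)] W(1)]
      by (rule openin_continuous_map_preimage)
    then show "open {s. \<gamma> s \<in> fst c \<inter> W}" by simp
    show "t \<in> {s. \<gamma> s \<in> fst c \<inter> W}" using c W by simp
    fix s assume s: "s \<in> {s. \<gamma> s \<in> fst c \<inter> W}"
    have "\<omega> (\<gamma> s) \<in> cotangent_space A (\<gamma> s)"
      using AVE by (simp add: satisfies_AVE_def C1_covector_section_def)
    then show "\<omega> (\<gamma> s) c \<bullet> coord c Y (snd c (\<gamma> s)) = pairing A (\<gamma> s) (\<omega> (\<gamma> s)) (Y (\<gamma> s))"
      using pairing_chart_independent[of "\<omega> (\<gamma> s)" A "\<gamma> s" "Y (\<gamma> s)" c] Y c s
      by (simp add: vector_field_def coord_chart[OF M])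
  qed
qed

section \<open>The obstruction integral\<close>

theorem theorem3p5:
  fixes M :: "'a topology" and A :: "('a, 'n::finite) chart set"
    and X :: "real \<Rightarrow> 'a \<Rightarrow> ('a, 'n) tvec" and X0 X1 Z :: "'a \<Rightarrow> ('a, 'n) tvec"
    and Zf :: "real \<Rightarrow> 'a \<Rightarrow> ('a, 'n) tvec" and \<omega> :: "'a \<Rightarrow> ('a, 'n) tvec"
    and \<gamma> :: "real \<Rightarrow> 'a" and T \<epsilon>0 \<epsilon>1 :: real and U V :: "'a set"
  assumes dim: "CARD('n) \<ge> 2"
    and manifold: "oriented_Ck_manifold 4 M A"
    and eps0: "\<epsilon>0 > 0"
    and X_family: "Ck_vector_field_family 3 A (topspace M) {0..<\<epsilon>0} X"
    and X0_field: "Ck_vector_field 3 A (topspace M) X0"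
    and X1_field: "vector_field A (topspace M) X1"
    and X_expansion: "\<And>p c. c \<in> A \<Longrightarrow> p \<in> fst c \<Longrightarrow>
        (\<lambda>\<epsilon>. norm (X \<epsilon> p c - (X0 p c + \<epsilon> *\<^sub>R X1 p c))) \<in> O[at_right 0](\<lambda>\<epsilon>. \<epsilon>\<^sup>2)"
    and period: "T > 0"
    and orbit: "periodic_orbit M A X0 T \<gamma>"
    and U: "openin M U" "\<gamma> ` {0..<T} \<subseteq> U"
    and Z_field: "Ck_vector_field 3 A U Z"
    and Z_commutes: "commute_on A U X0 Z"
    and Z_indep: "pointwise_lin_indep A U X0 Z"
    and AVE: "satisfies_AVE M A X0 \<gamma> \<omega>"
    and nontrivial: "\<exists>p\<in>\<gamma> ` {0..<T}. \<omega> p \<noteq> (\<lambda>_. 0)"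
    and V: "openin M V" "\<gamma> ` {0..<T} \<subseteq> V"
    and eps1: "0 < \<epsilon>1" "\<epsilon>1 \<le> \<epsilon>0"
    and Zf_field: "\<And>\<epsilon>. \<epsilon> \<in> {0..<\<epsilon>1} \<Longrightarrow> Ck_vector_field 3 A V (Zf \<epsilon>)"
    and Zf_family: "Ck_vector_field_family 2 A V {0..<\<epsilon>1} Zf"
    and Zf_commutes: "\<And>\<epsilon>. \<epsilon> \<in> {0..<\<epsilon>1} \<Longrightarrow> commute_on A V (X \<epsilon>) (Zf \<epsilon>)"
    and Zf_0: "\<And>p. p \<in> U \<inter> V \<Longrightarrow> Zf 0 p = Z p"
  shows "((\<lambda>t. pairing A (\<gamma> t) (\<omega> (\<gamma> t)) (lie_bracket A X1 Z (\<gamma> t))) has_integral 0) {0..T}"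
proof -
  \<comment> \<open>the orders of differentiability as successors, as the recursion of \<^const>\<open>Ck_on\<close> expects them\<close>
  have k4: "4 = Suc 3" "3 = Suc 2" by simp_all
  have top: "fst c \<inter> topspace M = fst c" "open (snd c ` fst c)" if "c \<in> A" for c
    using openin_subset[OF openin_chart_domain[OF manifold that]]
      open_chart_image[OF manifold that openin_topspace] by (auto simp: Int_absorb2)
  have curve: "integral_curve M A X0 \<gamma>" and per: "\<gamma> T = \<gamma> 0"
    using orbit unfolding periodic_orbit_def by (auto dest: spec[of _ 0])
  have on_orbit: "\<gamma> t \<in> U \<inter> V" if "t \<in> {0..T}" for t
    using that per period U V by (cases "t = T") auto
  have X2: "Ck_vector_field_family 2 A (topspace M) {0..<\<epsilon>0} X"
    using X_family Ck_on_Suc_imp[of 2] unfolding Ck_vector_field_family_def k4 by blast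
  have X_smooth: "Ck_on 2 (\<lambda>(x, e). coord c (X e) x) (snd c ` fst c \<times> {0..<\<epsilon>0})" if "c \<in> A" for c
    using X2 that top(1)[OF that] unfolding Ck_vector_field_family_def by metis
  have X_derivative: "((\<lambda>e. X e p c) has_vector_derivative vector_derivative (\<lambda>e. X e p c) (at_right 0)) (at_right 0)"
    if "c \<in> A" "p \<in> fst c" for p c
    using Ck_on_slice_derivatives(2)[of "snd c ` fst c" "snd c p" \<epsilon>0 "\<lambda>(x, e). coord c (X e) x"]
      X_smooth[OF that(1)] that top(2) eps0 by (simp add: coord_chart[OF manifold])
  have X_0: "X 0 p c = X0 p c" and X1: "((\<lambda>e. X e p c) has_vector_derivative X1 p c) (at_right 0)"
    if "c \<in> A" "p \<in> fst c" for p c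
    using first_order_expansion_at_right[OF X_derivative[OF that] X_expansion[OF that]]
      X_derivative[OF that] by simp_all
  \<comment> \<open>the first variation of the symmetry, normalised to 0 outside the charts around \<open>p\<close>\<close>
  define Z1 where "Z1 p = (\<lambda>c. if c \<in> A \<and> p \<in> fst c then
      vector_derivative (\<lambda>e. Zf e p c) (at_right 0) else 0)" for p
  have open_V: "open (snd c ` (fst c \<inter> V))" if "c \<in> A" for c
    by (rule open_chart_image[OF manifold that V(1)])
  have Zf_smooth: "Ck_on 2 (\<lambda>(x, e). coord c (Zf e) x) (snd c ` (fst c \<inter> V) \<times> {0..<\<epsilon>1})"
    if "c \<in> A" for c
    using Zf_family that unfolding Ck_vector_field_family_def by blast
  have Z1: "((\<lambda>e. Zf e p c) has_vector_derivative Z1 p c) (at_right 0)"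
    if "p \<in> V" "c \<in> A" "p \<in> fst c" for p c
    using Ck_on_slice_derivatives(2)[OF open_V[OF that(2)], of "snd c p" \<epsilon>1 "\<lambda>(x, e). coord c (Zf e) x"]
      Zf_smooth[OF that(2)] that eps1(1) by (simp add: coord_chart[OF manifold] Z1_def)
  have Z1_field: "vector_field A V Z1"
    unfolding vector_field_def
  proof
    fix p assume p: "p \<in> V"
    have tangent: "Zf e p \<in> tangent_space A p" if "e \<in> {0..<\<epsilon>1}" for e
      using Zf_family that p unfolding Ck_vector_field_family_def vector_field_def by blast
    have outside: "Z1 p c = 0" if "\<not> (c \<in> A \<and> p \<in> fst c)" for c
      using that unfolding Z1_def by (rule if_not_P)
    show "Z1 p \<in> tangent_space A p"
      by (rule tangent_space_parameter_derivative[where p = p and Y = "\<lambda>e. Zf e p" and b = \<epsilon>1,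
            OF manifold[unfolded k4(1)] eps1(1) tangent Z1[OF p] outside])
  qed
  have X0_diff: "coord c X0 differentiable at (snd c p)" if "c \<in> A" "p \<in> fst c" for c p
  proof -
    have "coord c X0 differentiable_on snd c ` fst c"
      using X0_field that(1) top(1)[OF that(1)] unfolding Ck_vector_field_def k4 Ck_on.simps by metis
    then show ?thesis
      using differentiable_on_eq_differentiable_at[OF top(2)[OF that(1)]] that(2) by blast
  qed
  have Z1_diff: "coord c Z1 differentiable at (snd c p)" if "c \<in> A" "p \<in> fst c" "p \<in> V" for c p
  proof (rule derivative_of_parameter_derivative(1)[OF open_V[OF that(1)] _ eps1(1) Zf_smooth[OF that(1)]])
    show "((\<lambda>e. case (y, e) of (y, e) \<Rightarrow> coord c (Zf e) y) has_vector_derivative coord c Z1 y) (at_right 0)"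
      if "y \<in> snd c ` (fst c \<inter> V)" for y
      using that Z1[OF _ \<open>c \<in> A\<close>] by (elim imageE) (simp add: coord_chart[OF manifold \<open>c \<in> A\<close>])
  qed (use that in blast)
  have bracket: "lie_bracket A X0 Z1 p = (\<lambda>c. - lie_bracket A X1 Z p c)" if p: "p \<in> U \<inter> V" for p
  proof -
    have UV: "openin M (U \<inter> V)" "p \<in> topspace M"
      using openin_Int[OF U(1) V(1)] openin_subset[OF U(1)] p by auto
    have "lie_bracket A (X 0) Z1 p = (\<lambda>c. - lie_bracket A X1 (Zf 0) p c)"
      by (rule commuting_families_first_variation[OF manifold openin_topspace UV(2) eps0 X2 X1
            V(1) _ eps1(1) Zf_family Z1 eps1(1)])
        (use Zf_commutes p in \<open>simp_all add: commute_on_def\<close>)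
    moreover have "lie_bracket A (X 0) Z1 p = lie_bracket A X0 Z1 p"
      by (rule lie_bracket_cong[OF manifold UV(1) p]) (simp_all add: X_0)
    moreover have "lie_bracket A X1 (Zf 0) p = lie_bracket A X1 Z p"
      by (rule lie_bracket_cong[OF manifold UV(1) p]) (simp_all add: Zf_0)
    ultimately show ?thesis by simp
  qed
  \<comment> \<open>\<open>?h\<close> is an antiderivative of minus the integrand with equal values at \<open>0\<close> and \<open>T\<close>\<close>
  let ?h = "\<lambda>t. pairing A (\<gamma> t) (\<omega> (\<gamma> t)) (Z1 (\<gamma> t))"
  have "(?h has_vector_derivative - pairing A (\<gamma> t) (\<omega> (\<gamma> t)) (lie_bracket A X1 Z (\<gamma> t)))
      (at t within {0..T})" if "t \<in> {0..T}" for t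
  proof -
    have "\<gamma> t \<in> V" using on_orbit[OF that] by simp
    from adjoint_variational_pairing_derivative[OF manifold curve AVE V(1) this Z1_field]
    have "(?h has_vector_derivative pairing A (\<gamma> t) (\<omega> (\<gamma> t)) (lie_bracket A X0 Z1 (\<gamma> t))) (at t)"
      using X0_diff Z1_diff \<open>\<gamma> t \<in> V\<close> by blast
    also have "pairing A (\<gamma> t) (\<omega> (\<gamma> t)) (lie_bracket A X0 Z1 (\<gamma> t))
        = - pairing A (\<gamma> t) (\<omega> (\<gamma> t)) (lie_bracket A X1 Z (\<gamma> t))"
      by (simp add: bracket[OF on_orbit[OF that]] pairing_def Let_def)
    finally show ?thesis by (rule has_vector_derivative_at_within)
  qed
  then have "((\<lambda>t. - pairing A (\<gamma> t) (\<omega> (\<gamma> t)) (lie_bracket A X1 Z (\<gamma> t))) has_integral ?h T - ?h 0) {0..T}"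
    using period by (intro fundamental_theorem_of_calculus) auto
  from has_integral_neg[OF this] show ?thesis
    by (simp add: per)
qed

end
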